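(* Let $\Sigma_4=\{0,1,2,3\}$ and let $\mathbf w$ be any infinite word over $\Sigma_4$ that is squarefree and contains no occurrence of any of the subwords $12$, $13$, $21$, $32$, $231$, $10302$. Define the morphism $g:\Sigma_4^*\to\{0,1\}^*$ by $g(0)=010011$, $g(1)=010110$, $g(2)=011001$, $g(3)=011010$. Then $g(\mathbf w)$ is cubefree and contains no square $xx$ with $|x|\ge 4$.
   Context: A square is a nonempty word $xx$, a cube a nonempty word $xxx$. A word is squarefree (resp. cubefree) if no subword is a square (resp. cube). A morphism is applied to an infinite word letter by letter. *)

theory Defs
  imports "HOL-Library.Stream"
begin

definition factor_of :: "'a list \<Rightarrow> 'a stream \<Rightarrow> bool" where
  "factor_of v s \<longleftrightarrow> (\<exists>u t. s = u @- v @- t)"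

definition is_square :: "'a list \<Rightarrow> bool" where
  "is_square v \<longleftrightarrow> (\<exists>x. x \<noteq> [] \<and> v = x @ x)"

definition is_cube :: "'a list \<Rightarrow> bool" where
  "is_cube v \<longleftrightarrow> (\<exists>x. x \<noteq> [] \<and> v = x @ x @ x)"

definition squarefree_word :: "'a stream \<Rightarrow> bool" where
  "squarefree_word s \<longleftrightarrow> \<not> (\<exists>v. factor_of v s \<and> is_square v)"

definition cubefree_word :: "'a stream \<Rightarrow> bool" where
  "cubefree_word s \<longleftrightarrow> \<not> (\<exists>v. factor_of v s \<and> is_cube v)"

(* Only applied to nonempty images h a; the library function flat is not concatenation otherwise. *)
definition apply_morphism :: "('a \<Rightarrow> 'b list) \<Rightarrow> 'a stream \<Rightarrow> 'b stream" where
  "apply_morphism h s = flat (smap h s)"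

(* The value outside the alphabet {0,1,2,3} is a dummy. *)
definition g :: "nat \<Rightarrow> nat list" where
  "g a =
    (if a = 0 then [0,1,0,0,1,1]
     else if a = 1 then [0,1,0,1,1,0]
     else if a = 2 then [0,1,1,0,0,1]
     else if a = 3 then [0,1,1,0,1,0]
     else undefined)"

end

theory Submission
  imports Defs
begin

text \<open>
  Every factor of length 9 of the image word determines its position modulo 6, so a square whose
  period is at least 9 has period \<open>6 * q\<close>; the shorter periods, and the short cubes, are excluded
  by inspecting the images of the words of length 3 and 4 that can occur in \<open>w\<close>. A square of period
  \<open>6 * q\<close> comes from a factor \<open>a u b u c\<close> of \<open>w\<close> with \<open>|u| = q - 1\<close>. The prefixes and suffixes of
  the four code words force \<open>a = b\<close> or \<open>b = c\<close>, which gives a square in \<open>w\<close>, or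
  \<open>(a, b, c) = (1, 3, 2)\<close>. In the last case, \<open>u\<close> begins with \<open>02\<close> and ends with \<open>10\<close> (or
  \<open>u = 0\<close>), so that \<open>10302\<close> occurs in \<open>w\<close>.
\<close>

subsection \<open>Factors of streams\<close>

lemma factor_of_iff_stake: "factor_of v s \<longleftrightarrow> (\<exists>i. stake (length v) (sdrop i s) = v)"
proof
  assume "factor_of v s"
  then obtain u t where "s = u @- v @- t"
    unfolding factor_of_def by blast
  then have "stake (length v) (sdrop (length u) s) = v"
    by (simp add: sdrop_shift stake_shift)
  then show "\<exists>i. stake (length v) (sdrop i s) = v" ..
next
  assume "\<exists>i. stake (length v) (sdrop i s) = v"
  then obtain i where "stake (length v) (sdrop i s) = v" ..
  then have "s = stake i s @- v @- sdrop (length v) (sdrop i s)"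
    by (metis stake_sdrop)
  then show "factor_of v s"
    unfolding factor_of_def by blast
qed

lemma factor_of_square_iff:
  "factor_of (x @ x) s \<longleftrightarrow>
    (\<exists>i. stake (length x) (sdrop i s) = x \<and> stake (length x) (sdrop (i + length x) s) = x)"
  by (simp add: factor_of_iff_stake append_eq_append_conv flip: stake_add)

lemma factor_of_append_left: "factor_of (x @ y) s \<Longrightarrow> factor_of x s"
  unfolding factor_of_def by (metis shift_append)

text \<open>If \<open>q\<close> consecutive letters agreed with their shifts by \<open>q\<close>,
  they would spell a square. The period arguments on \<open>w\<close> use this letterwise
  form.\<close>

lemma squarefree_word_snth:
  assumes "squarefree_word s" and "0 < q"
  shows "\<exists>n. i \<le> n \<and> n < i + q \<and> s !! n \<noteq> s !! (n + q)"
proof (rule ccontr)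
  assume eq: "\<not> ?thesis"
  let ?x = "stake q (sdrop i s)"
  have "stake q (sdrop (i + q) s) = ?x"
  proof (rule nth_equalityI)
    fix k
    assume "k < length (stake q (sdrop (i + q) s))"
    then show "stake q (sdrop (i + q) s) ! k = ?x ! k"
      using eq by (auto simp: sdrop_snth ac_simps)
  qed simp
  then have "factor_of (?x @ ?x) s"
    unfolding factor_of_square_iff by auto
  moreover have "is_square (?x @ ?x)"
    unfolding is_square_def using assms(2) by (metis length_0_conv length_stake less_not_refl)
  ultimately show False
    using assms(1) unfolding squarefree_word_def by blast
qed

subsection \<open>Uniform morphisms\<close>

lemma apply_morphism_unfold:
  assumes "\<And>a. a \<in> sset s \<Longrightarrow> h a \<noteq> []"
  shows "apply_morphism h s = concat (map h (stake n s)) @- apply_morphism h (sdrop n s)"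
  using assms
proof (induction n arbitrary: s)
  case (Suc n)
  have "apply_morphism h s = h (shd s) @- apply_morphism h (stl s)"
    using Suc.prems[of "shd s"] unfolding apply_morphism_def
    by (cases s) simp
  then show ?case
    using Suc.IH[of "stl s"] Suc.prems by (simp add: stl_sset)
qed simp

lemma length_concat_uniform:
  "(\<And>a. a \<in> set v \<Longrightarrow> length (h a) = k) \<Longrightarrow> length (concat (map h v)) = k * length v"
  by (induction v) auto

lemma sset_sdrop_subset: "sset (sdrop n s) \<subseteq> sset s"
  by (auto simp: sset_range sdrop_snth)

lemma set_stake_subset: "set (stake n s) \<subseteq> sset s"
  by (metis sset_shift stake_sdrop sup_ge1)

text \<open>Block \<open>j\<close> of a \<open>k\<close>-uniform image starts at position
  \<open>k * j\<close>, so a window that fits into \<open>m\<close> blocks depends on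
  \<open>m\<close> letters of \<open>s\<close> only. This reduces questions on short factors to
  finite checks.\<close>

lemma stake_sdrop_apply_morphism:
  assumes unif: "\<And>a. a \<in> sset s \<Longrightarrow> length (h a) = k" and k: "0 < k"
    and le: "r + l \<le> k * m"
  shows "stake l (sdrop (k * j + r) (apply_morphism h s)) =
    take l (drop r (concat (map h (stake m (sdrop j s)))))"
proof -
  have unif': "length (h a) = k" if "a \<in> sset (sdrop j s)" for a
    using unif that sset_sdrop_subset[of j s] by auto
  have ne: "h a \<noteq> []" if "a \<in> sset s" for a
    using unif[OF that] k by auto
  have ne': "h a \<noteq> []" if "a \<in> sset (sdrop j s)" for a
    using unif'[OF that] k by auto
  have "set (stake j s) \<subseteq> sset s" "set (stake m (sdrop j s)) \<subseteq> sset (sdrop j s)"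
    by (rule set_stake_subset)+
  then have len: "length (concat (map h (stake j s))) = k * j"
    "length (concat (map h (stake m (sdrop j s)))) = k * m"
    using length_concat_uniform[of "stake j s" h k]
      length_concat_uniform[of "stake m (sdrop j s)" h k] unif unif' by auto
  have "sdrop (k * j) (apply_morphism h s) = apply_morphism h (sdrop j s)"
    by (subst apply_morphism_unfold[of s h j, OF ne]) (simp_all add: sdrop_shift len(1))
  then have "sdrop (k * j + r) (apply_morphism h s) = sdrop r (apply_morphism h (sdrop j s))"
    by (metis sdrop_add)
  also have "\<dots> = drop r (concat (map h (stake m (sdrop j s)))) @-
      apply_morphism h (sdrop m (sdrop j s))"
    using le
    by (subst apply_morphism_unfold[of "sdrop j s" h m, OF ne'])
      (simp_all add: sdrop_shift len(2) del: sdrop_add)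
  finally show ?thesis
    using len(2) le by (simp add: stake_shift)
qed

subsection \<open>Short words\<close>

text \<open>A local test: apart from the forbidden words of length at most 3, it rejects only
  squares of period 1 and 2. In the enumerated words, of length 3 and 4, no longer square and no
  \<open>10302\<close> would fit.\<close>

fun admissible :: "nat list \<Rightarrow> bool" where
  "admissible (a # b # v) \<longleftrightarrow>
    a \<noteq> b \<and> (a, b) \<notin> {(1,2), (1,3), (2,1), (3,2)} \<and> take 2 v \<noteq> [a, b] \<and>
    (a, b, take 1 v) \<noteq> (2, 3, [1]) \<and> admissible (b # v)"
| "admissible v \<longleftrightarrow> True"

definition admissible_words :: "nat \<Rightarrow> nat list list" where
  "admissible_words n = filter admissible (List.n_lists n [0, 1, 2, 3])"

text \<open>An offset of at most 5 plus twice the period is at most 21, so four blocks of 6 letters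
  suffice. Period 6 is absent because it falls under the multiples of 6.\<close>

lemma admissible_words_images_no_short_square:
  "\<forall>v \<in> set (admissible_words 4). \<forall>r \<in> set [0..<6]. \<forall>p \<in> set [4, 5, 7, 8].
    take p (drop r (concat (map g v))) \<noteq> take p (drop (r + p) (concat (map g v)))"
  by code_simp

lemma admissible_words_images_no_short_cube:
  "\<forall>v \<in> set (admissible_words 3). \<forall>r \<in> set [0..<6]. \<forall>p \<in> set [1, 2, 3].
    take p (drop r (concat (map g v))) \<noteq> take p (drop (r + p) (concat (map g v))) \<or>
    take p (drop r (concat (map g v))) \<noteq> take p (drop (r + 2 * p) (concat (map g v)))"
  by code_simp

text \<open>Nine letters at offset at most 5 fit into three blocks; by symmetry, the pairs with
  \<open>r' < r\<close> are enough.\<close>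

lemma admissible_words_images_synchronize:
  "\<forall>v \<in> set (admissible_words 3). \<forall>v' \<in> set (admissible_words 3).
    \<forall>r \<in> set [0..<6]. \<forall>r' \<in> set [0..<r].
      take 9 (drop r (concat (map g v))) \<noteq> take 9 (drop r' (concat (map g v')))"
  by code_simp


subsection \<open>The image word\<close>

lemma g_eqI_suffix:
  assumes "a \<in> {0,1,2,3}" "b \<in> {0,1,2,3}"
    and "g a ! 3 = g b ! 3" "g a ! 4 = g b ! 4" "g a ! 5 = g b ! 5"
  shows "a = b"
  using assms by (auto simp: g_def)

text \<open>All code words begin with \<open>01\<close>, so only letters 2 to 4 of a prefix of
  length 5 can distinguish them.\<close>

lemma g_eqI_prefix:
  assumes "a \<in> {0,1,2,3}" "b \<in> {0,1,2,3}"
    and "g a ! 2 = g b ! 2" "g a ! 3 = g b ! 3" "g a ! 4 = g b ! 4"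
  shows "a = b"
  using assms by (auto simp: g_def)

text \<open>The last two letters confuse only 1 with 3, and the first four confuse only 2 with 3. If
  both neighbours differ from \<open>b\<close>, then \<open>b = 3\<close>.\<close>

lemma g_split_4_2:
  assumes "a \<in> {0,1,2,3}" "b \<in> {0,1,2,3}" "c \<in> {0,1,2,3}"
    and "g a ! 4 = g b ! 4" "g a ! 5 = g b ! 5"
    and "g b ! 2 = g c ! 2" "g b ! 3 = g c ! 3"
  shows "a = b \<or> b = c \<or> (a = 1 \<and> b = 3 \<and> c = 2)"
  using assms by (auto simp: g_def)

section \<open>Local constraints on the word w\<close>

locale restricted_word =
  fixes w :: "nat stream"
  assumes letters: "w \<in> streams {0, 1, 2, 3}"
    and squarefree: "squarefree_word w"
    and avoids: "\<forall>v \<in> {[1,2], [1,3], [2,1], [3,2], [2,3,1], [1,0,3,0,2]}. \<not> factor_of v w"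
begin

lemma snth_letter: "w !! n \<in> {0, 1, 2, 3}"
  using letters by (meson snth_in)

lemma not_factor_at:
  assumes "v \<in> {[1,2], [1,3], [2,1], [3,2], [2,3,1], [1,0,3,0,2]}"
  shows "stake (length v) (sdrop n w) \<noteq> v"
  using avoids assms factor_of_iff_stake by blast

lemma avoids_snth:
  "w !! n = 1 \<Longrightarrow> w !! Suc n \<noteq> 2"
  "w !! n = 1 \<Longrightarrow> w !! Suc n \<noteq> 3"
  "w !! n = 2 \<Longrightarrow> w !! Suc n \<noteq> 1"
  "w !! n = 3 \<Longrightarrow> w !! Suc n \<noteq> 2"
  "w !! n = 2 \<Longrightarrow> w !! Suc n = 3 \<Longrightarrow> w !! Suc (Suc n) \<noteq> 1"
  "w !! n = 1 \<Longrightarrow> w !! Suc n = 0 \<Longrightarrow> w !! Suc (Suc n) = 3 \<Longrightarrow>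
    w !! Suc (Suc (Suc n)) = 0 \<Longrightarrow> w !! Suc (Suc (Suc (Suc n))) \<noteq> 2"
  using not_factor_at[of "[1,2]" n] not_factor_at[of "[1,3]" n] not_factor_at[of "[2,1]" n]
    not_factor_at[of "[3,2]" n] not_factor_at[of "[2,3,1]" n] not_factor_at[of "[1,0,3,0,2]" n]
  by (auto simp: sdrop_simps)

lemma snth_Suc_neq: "w !! n \<noteq> w !! Suc n"
  using squarefree_word_snth[OF squarefree, of 1 n] by (auto simp: less_Suc_eq)

lemma snth_no_square_2:
  "w !! n = w !! Suc (Suc n) \<Longrightarrow> w !! Suc n \<noteq> w !! Suc (Suc (Suc n))"
  using squarefree_word_snth[OF squarefree, of 2 n]
  by (auto simp: numeral_2_eq_2 less_Suc_eq)

lemma stake_admissible: "admissible (stake n (sdrop i w))"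
proof (induction n arbitrary: i)
  case (Suc n)
  show ?case
  proof (cases n)
    case (Suc m)
    have "take 2 (stake m (sdrop (Suc (Suc i)) w)) \<noteq> [w !! i, w !! Suc i]"
      using snth_no_square_2[of i]
      by (cases "m < 2") (auto simp: take_stake min_def numeral_2_eq_2 less_Suc_eq)
    moreover have "w !! i = 2 \<Longrightarrow> w !! Suc i = 3 \<Longrightarrow>
        take 1 (stake m (sdrop (Suc (Suc i)) w)) \<noteq> [1]"
      using avoids_snth(5)[of i] by (cases m) (auto simp: sdrop_simps)
    ultimately show ?thesis
      using Suc.IH[of "Suc i"] snth_Suc_neq[of i] avoids_snth[of i] \<open>n = Suc m\<close>
      by (auto simp: sdrop_simps simp del: sdrop.simps)
  qed simp
qed simp

lemma stake_in_admissible_words: "stake n (sdrop i w) \<in> set (admissible_words n)"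
proof -
  have "set (stake n (sdrop i w)) \<subseteq> {0, 1, 2, 3}"
    using set_stake_subset[of n "sdrop i w"] sset_sdrop_subset[of i w] letters
    unfolding streams_iff_sset by blast
  then show ?thesis
    using stake_admissible by (simp add: admissible_words_def set_n_lists)
qed

section \<open>Windows and letters of the image\<close>

abbreviation image :: "nat stream" where
  "image \<equiv> apply_morphism g w"

lemma length_g_sset: "a \<in> sset w \<Longrightarrow> length (g a) = 6"
  using letters by (auto simp: streams_iff_sset g_def)

lemma image_window:
  "r + l \<le> 6 * m \<Longrightarrow> stake l (sdrop (6 * j + r) image) =
    take l (drop r (concat (map g (stake m (sdrop j w)))))"
  by (rule stake_sdrop_apply_morphism[OF length_g_sset]) auto

lemma image_snth:
  assumes "r < 6"
  shows "image !! (6 * n + r) = g (w !! n) ! r"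
proof -
  have "[image !! (6 * n + r)] = take 1 (drop r (g (w !! n)))"
    using image_window[of r 1 1 n] assms by simp
  also have "\<dots> = [g (w !! n) ! r]"
    using length_g_sset[of "w !! n"] assms
    by (simp add: sset_range hd_drop_conv_nth take_Suc)
  finally show ?thesis by simp
qed

section \<open>Squares whose period is a multiple of 6\<close>

text \<open>Here \<open>1 u 3 u 2\<close> occurs with \<open>u\<close> of length
  \<open>q - 1\<close>. Only 0 may follow 1 and only 0 may precede 2, so \<open>u\<close> begins and
  ends with 0; once its neighbouring letters are known, \<open>10302\<close> appears around the
  middle 3.\<close>

lemma no_132_factor:
  assumes "w !! j = 1" "w !! (j + q) = 3" "w !! (j + 2 * q) = 2"
    and per: "\<And>n. j < n \<Longrightarrow> n < j + q \<Longrightarrow> w !! n = w !! (n + q)"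
  shows False
proof -
  have "q \<noteq> 0"
    using assms(1,2) by (cases "q = 0") simp_all
  moreover have "q \<noteq> 1"
    using assms(1,2) avoids_snth(2)[of j] by (cases "q = 1") simp_all
  ultimately obtain k where q: "q = k + 2"
    by (metis One_nat_def add_2_eq_Suc' not0_implies_Suc)
  have first: "w !! (j + 1) = 0"
    using avoids_snth(1,2)[of j] snth_Suc_neq[of j] snth_letter[of "j + 1"] assms(1) by auto
  have last: "w !! (j + 2 * q - 1) = 0"
    using avoids_snth(1,4)[of "j + 2 * q - 1"] snth_Suc_neq[of "j + 2 * q - 1"]
      snth_letter[of "j + 2 * q - 1"] assms(3) q by auto
  have first': "w !! (j + q + 1) = 0" and last': "w !! (j + q - 1) = 0"
    using per[of "j + 1"] per[of "j + q - 1"] first last q by (auto simp: ac_simps mult_2 mult_2_right)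
  \<comment> \<open>The length of \<open>u\<close> is \<open>k + 1\<close>: \<open>u = 0\<close>
    gives \<open>10302\<close> at once, length 2 gives the square \<open>00\<close>, and otherwise
    \<open>u\<close> has a second and a penultimate letter to determine.\<close>
  consider "k = 0" | "k = 1" | m where "k = m + 2"
    by (metis One_nat_def add_2_eq_Suc' not0_implies_Suc)
  then show False
  proof cases
    case 1
    then show False
      using avoids_snth(6)[of j] first first' assms q by (simp add: numeral_eq_Suc)
  next
    case 2
    then show False
      using snth_Suc_neq[of "j + 1"] first last' q by simp
  next
    case 3
    have per2: "w !! (j + 2) = w !! (j + q + 2)" "w !! (j + q - 2) = w !! (j + 2 * q - 2)"
      using per[of "j + 2"] per[of "j + q - 2"] q 3 by (auto simp: ac_simps mult_2 mult_2_right)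
    \<comment> \<open>The second letter of \<open>u\<close> is 2: 0 gives \<open>00\<close>, 1
      forces \<open>1010\<close> at the left end, and 3 gives \<open>0303\<close> across the
      middle.\<close>
    have "w !! (j + 2) \<noteq> 0"
      using snth_Suc_neq[of "j + 1"] first by simp
    moreover have "w !! (j + 2) \<noteq> 1"
    proof
      assume "w !! (j + 2) = 1"
      then show False
        using snth_no_square_2[of j] avoids_snth(1,2)[of "j + 2"] snth_Suc_neq[of "j + 2"]
          snth_letter[of "j + 3"] first assms(1) by (auto simp: numeral_eq_Suc)
    qed
    moreover have "w !! (j + 2) \<noteq> 3"
      using snth_no_square_2[of "j + q - 1"] last' first' assms(2) per2(1) q
      by (auto simp: numeral_eq_Suc)
    ultimately have second: "w !! (j + q + 2) = 2"
      using snth_letter[of "j + 2"] per2(1) by auto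
    \<comment> \<open>The penultimate letter of \<open>u\<close> is 1: 0 gives \<open>00\<close>, 3
      gives \<open>3030\<close> across the middle, and 2 forces \<open>0202\<close> at the right
      end.\<close>
    have "w !! (j + q - 2) \<noteq> 0"
      using snth_Suc_neq[of "j + q - 2"] last' q by simp
    moreover have "w !! (j + q - 2) \<noteq> 3"
      using snth_no_square_2[of "j + q - 2"] last' first' assms(2) q by auto
    moreover have "w !! (j + q - 2) \<noteq> 2"
    proof
      assume "w !! (j + q - 2) = 2"
      then have two: "w !! (j + 2 * q - 2) = 2"
        using per2(2) by simp
      then have "w !! (j + 2 * q - 3) = 0"
        using avoids_snth(1,4)[of "j + 2 * q - 3"] snth_Suc_neq[of "j + 2 * q - 3"]
          snth_letter[of "j + 2 * q - 3"] q 3 by (auto simp: numeral_eq_Suc)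
      then show False
        using snth_no_square_2[of "j + 2 * q - 3"] last two assms(3) q 3
        by (auto simp: numeral_eq_Suc)
    qed
    ultimately have "w !! (j + q - 2) = 1"
      using snth_letter[of "j + q - 2"] by auto
    then show False
      using avoids_snth(6)[of "j + q - 2"] last' assms(2) first' second q
      by (simp add: numeral_eq_Suc)
  qed
qed

lemma image_no_square_mult_6:
  assumes "0 < q"
  shows "\<not> (\<forall>k < 6 * q. image !! (i + k) = image !! (i + k + 6 * q))"
proof
  assume square: "\<forall>k < 6 * q. image !! (i + k) = image !! (i + k + 6 * q)"
  define j r where "j = i div 6" and "r = i mod 6"
  have i: "i = 6 * j + r" and r: "r < 6"
    by (auto simp: j_def r_def)
  have eq: "g (w !! n) ! s = g (w !! (n + q)) ! s"
    if "s < 6" "i \<le> 6 * n + s" "6 * n + s < i + 6 * q" for n s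
  proof -
    have "image !! (6 * n + s) = image !! (6 * n + s + 6 * q)"
      using square[rule_format, of "6 * n + s - i"] that by simp
    also have "6 * n + s + 6 * q = 6 * (n + q) + s"
      by simp
    finally show ?thesis
      using that(1) by (simp only: image_snth)
  qed
  \<comment> \<open>The blocks strictly between \<open>j\<close> and \<open>j + q\<close> lie
    entirely in the first half of the square.\<close>
  have per: "w !! n = w !! (n + q)" if "j < n" "n < j + q" for n
  proof -
    have "i \<le> 6 * n" "6 * n + 5 < i + 6 * q"
      using that i r by auto
    then show ?thesis
      by (intro g_eqI_suffix[OF snth_letter snth_letter]; intro eq; simp)
  qed
  \<comment> \<open>The \<open>q - 1\<close> matches in \<open>per\<close>, extended by one more at
    either end, would give a square in \<open>w\<close>.\<close>
  have ends: "w !! j \<noteq> w !! (j + q)" "w !! (j + q) \<noteq> w !! (j + 2 * q)"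
  proof
    assume "w !! j = w !! (j + q)"
    then show False
      using squarefree_word_snth[OF squarefree assms, of j] per
      by (metis le_neq_implies_less)
  next
    show "w !! (j + q) \<noteq> w !! (j + 2 * q)"
    proof
      assume "w !! (j + q) = w !! (j + 2 * q)"
      moreover obtain n where "Suc j \<le> n" "n < Suc j + q" "w !! n \<noteq> w !! (n + q)"
        using squarefree_word_snth[OF squarefree assms, of "Suc j"] by blast
      ultimately show False
        using per[of n] by (cases "n = j + q") (auto simp: mult_2 add.assoc)
    qed
  qed
  \<comment> \<open>The first half contains the last \<open>6 - r\<close> letters of block
    \<open>j\<close> and the first \<open>r\<close> letters of block \<open>j + q\<close>. For
    \<open>r \<le> 3\<close> the suffix determines its letter, for \<open>r = 5\<close> the prefix
    does; \<open>r = 4\<close> leaves the ambiguous split.\<close>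
  consider "r \<le> 3" | "r = 4" | "r = 5"
    using r by linarith
  then show False
  proof cases
    case 1
    then have "w !! j = w !! (j + q)"
      using i assms by (intro g_eqI_suffix[OF snth_letter snth_letter]; intro eq; simp)
    then show False
      using ends by simp
  next
    case 2
    have "g (w !! j) ! 4 = g (w !! (j + q)) ! 4" "g (w !! j) ! 5 = g (w !! (j + q)) ! 5"
      using i 2 assms by (auto intro!: eq)
    moreover have "g (w !! (j + q)) ! 2 = g (w !! (j + q + q)) ! 2"
      "g (w !! (j + q)) ! 3 = g (w !! (j + q + q)) ! 3"
      using i 2 assms by (auto intro!: eq)
    ultimately have "w !! j = 1" "w !! (j + q) = 3" "w !! (j + 2 * q) = 2"
      using g_split_4_2[OF snth_letter snth_letter snth_letter, of j "j + q" "j + q + q"] ends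
      by (auto simp: mult_2 add.assoc)
    then show False
      using no_132_factor per by blast
  next
    case 3
    then have "w !! (j + q) = w !! (j + q + q)"
      using i assms by (intro g_eqI_prefix[OF snth_letter snth_letter]; intro eq; simp)
    then show False
      using ends by (simp add: mult_2 add.assoc)
  qed
qed

section \<open>Synchronization and the remaining periods\<close>

lemma image_synchronizing:
  assumes "stake 9 (sdrop i image) = stake 9 (sdrop i' image)"
  shows "i mod 6 = i' mod 6"
proof -
  have less: False
    if "stake 9 (sdrop a image) = stake 9 (sdrop b image)" "b mod 6 < a mod 6" for a b
  proof -
    have "stake 9 (sdrop (6 * (n div 6) + n mod 6) image) =
        take 9 (drop (n mod 6) (concat (map g (stake 3 (sdrop (n div 6) w)))))" for n
    proof (rule image_window)
      have "n mod 6 < 6" by simp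
      then show "n mod 6 + 9 \<le> 6 * 3" by linarith
    qed
    then have "stake 9 (sdrop n image) =
        take 9 (drop (n mod 6) (concat (map g (stake 3 (sdrop (n div 6) w)))))" for n
      by simp
    moreover have "a mod 6 \<in> set [0..<6]" "b mod 6 \<in> set [0..<a mod 6]"
      using that(2) by auto
    ultimately show False
      using admissible_words_images_synchronize stake_in_admissible_words that(1) by metis
  qed
  show ?thesis
    using less[of i i'] less[of i' i] assms by (metis linorder_neqE_nat)
qed

lemma image_no_long_square:
  assumes "4 \<le> length x"
  shows "\<not> factor_of (x @ x) image"
proof
  let ?p = "length x"
  assume "factor_of (x @ x) image"
  then obtain i where x: "stake ?p (sdrop i image) = x" "stake ?p (sdrop (i + ?p) image) = x"
    unfolding factor_of_square_iff by blast
  \<comment> \<open>Periods from 9 on are synchronized; below 9, all but 6 are ruled out by the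
    finite check.\<close>
  have "?p mod 6 = 0"
  proof (cases "9 \<le> ?p")
    case True
    then have "stake 9 (sdrop i image) = stake 9 (sdrop (i + ?p) image)"
      using x by (metis min.absorb1 take_stake)
    then have "i mod 6 = (i + ?p) mod 6"
      by (rule image_synchronizing)
    then show ?thesis
      by presburger
  next
    case False
    show ?thesis
    proof (rule ccontr)
      assume "?p mod 6 \<noteq> 0"
      then have p: "?p \<in> set [4, 5, 7, 8]"
        using False assms by (simp add: mod_eq_0_iff_dvd) presburger
      define j r where "j = i div 6" and "r = i mod 6"
      have i: "i = 6 * j + r" and r: "r < 6"
        by (auto simp: j_def r_def)
      let ?v = "stake 4 (sdrop j w)"
      have "x = take ?p (drop r (concat (map g ?v)))"
        using x(1) image_window[of r ?p 4 j] i r False by simp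
      moreover have "x = take ?p (drop (r + ?p) (concat (map g ?v)))"
        using x(2) image_window[of "r + ?p" ?p 4 j] i r False by (simp add: add.assoc)
      ultimately show False
        using admissible_words_images_no_short_square stake_in_admissible_words[of 4 j] p r
        by (metis atLeastLessThan_iff atLeastLessThan_upt le0)
    qed
  qed
  then obtain q where q: "?p = 6 * q"
    by (metis mod_0_imp_dvd dvdE)
  have "image !! (i + k) = image !! (i + k + 6 * q)" if "k < 6 * q" for k
  proof -
    have "image !! (i + k) = x ! k" "image !! (i + ?p + k) = x ! k"
      using x that q by (metis sdrop_snth stake_nth)+
    then show ?thesis
      using q by (simp add: ac_simps)
  qed
  moreover have "0 < q"
    using q assms by auto
  ultimately show False
    using image_no_square_mult_6 by blast
qed

text \<open>A cube contains the square of its root, so the root has at most 3 letters. With an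
  offset of at most 5 such a cube lies within three blocks, where the finite check applies.\<close>

lemma cubefree_image: "cubefree_word image"
  unfolding cubefree_word_def is_cube_def
proof clarify
  fix x :: "nat list"
  let ?p = "length x"
  assume cube: "factor_of (x @ x @ x) image" and "x \<noteq> []"
  then have "factor_of (x @ x) image"
    using factor_of_append_left[of "x @ x" x] by simp
  then have "\<not> 4 \<le> ?p"
    using image_no_long_square by blast
  moreover have "?p \<noteq> 0"
    using \<open>x \<noteq> []\<close> by simp
  ultimately have "?p = 1 \<or> ?p = 2 \<or> ?p = 3"
    by linarith
  then have p: "?p \<in> set [1, 2, 3]" and p3: "?p \<le> 3"
    by auto
  obtain i where "stake (length (x @ x @ x)) (sdrop i image) = x @ x @ x"
    using cube unfolding factor_of_iff_stake by blast
  then have x: "stake ?p (sdrop i image) = x" "stake ?p (sdrop (i + ?p) image) = x"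
    "stake ?p (sdrop (i + 2 * ?p) image) = x"
    by (simp_all add: append_eq_append_conv mult_2 add.assoc flip: stake_add)
  define j r where "j = i div 6" and "r = i mod 6"
  have i: "i = 6 * j + r" and r: "r < 6"
    by (auto simp: j_def r_def)
  let ?v = "stake 3 (sdrop j w)"
  have "x = take ?p (drop r (concat (map g ?v)))"
    using x(1) image_window[of r ?p 3 j] i r p3 by simp
  moreover have "x = take ?p (drop (r + ?p) (concat (map g ?v)))"
    using x(2) image_window[of "r + ?p" ?p 3 j] i r p3 by (simp add: add.assoc)
  moreover have "x = take ?p (drop (r + 2 * ?p) (concat (map g ?v)))"
    using x(3) image_window[of "r + 2 * ?p" ?p 3 j] i r p3 by (simp add: add.assoc)
  ultimately show False
    using admissible_words_images_no_short_cube stake_in_admissible_words[of 3 j] p r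
    by (metis atLeastLessThan_iff atLeastLessThan_upt le0)
qed

end

theorem theorem3:
  fixes w :: "nat stream"
  assumes "w \<in> streams {0, 1, 2, 3}"
    and "squarefree_word w"
    and "\<forall>v \<in> {[1,2], [1,3], [2,1], [3,2], [2,3,1], [1,0,3,0,2]}. \<not> factor_of v w"
  shows "cubefree_word (apply_morphism g w)
    \<and> \<not> (\<exists>x. length x \<ge> 4 \<and> factor_of (x @ x) (apply_morphism g w))"
proof -
  interpret restricted_word w
    using assms by unfold_locales
  show ?thesis
    using cubefree_image image_no_long_square by blast
qed

end
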